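(* Let $l\ge 1$ be an integer. Then, as $x\to\infty$, $$\frac1x\sum_{n\le x}\tilde A_l(n)\sim \alpha_l\, x^{\beta_l-1},\qquad\text{where}\quad \beta_l=\zeta^{-1}\!\left(\frac{l+1}{l}\right)\quad\text{and}\quad \alpha_l=-\frac{1}{l\,\beta_l\,\zeta'(\beta_l)}.$$
   Context: For an integer $l\ge 1$, an $l$-colored part is a pair $(d,c)$ with $d\ge 2$ an integer (its value) and $c\in\{1,\dots,l\}$ (its color). An ordered $l$-colored factorization of an integer $n\ge 2$ is a finite sequence of $l$-colored parts whose values have product $n$ (one-part sequences are included; repetitions are allowed). $\tilde A_l(n)$ is the number of ordered $l$-colored factorizations of $n$, and $\tilde A_l(1)=1$. $\zeta$ is the Riemann zeta function, and for real $y>1$, $\zeta^{-1}(y)$ denotes the unique real $s>1$ with $\zeta(s)=y$. The notation $F(x)\sim G(x)$ means $F(x)/G(x)\to 1$. *)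

theory Defs
  imports "HOL-Analysis.Analysis" "HOL-Library.Landau_Symbols"
begin

text \<open>
  An \<open>l\<close>-colored part is a pair \<open>(d, c)\<close> of a value \<open>d \<ge> 2\<close> and a color \<open>c \<in> {1..l}\<close>.
\<close>

definition colored_parts :: "nat \<Rightarrow> (nat \<times> nat) set" where
  "colored_parts l = {2..} \<times> {1..l}"

definition ordered_colored_factorizations :: "nat \<Rightarrow> nat \<Rightarrow> (nat \<times> nat) list set" where
  "ordered_colored_factorizations l n =
     {ps. set ps \<subseteq> colored_parts l \<and> prod_list (map fst ps) = n}"

text \<open>
  The empty list has product 1, so it is excluded for \<open>n \<ge> 2\<close>, and it realizes the
  convention that the count at \<open>n = 1\<close> is 1.
\<close>

definition num_colored_factorizations :: "nat \<Rightarrow> nat \<Rightarrow> nat" where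
  "num_colored_factorizations l n = card (ordered_colored_factorizations l n)"

lemma length_less_prod_list:
  assumes "set ps \<subseteq> colored_parts l"
  shows   "length ps < prod_list (map fst ps)"
  using assms
proof (induction ps)
  case (Cons p ps)
  then have "2 \<le> fst p" "length ps < prod_list (map fst ps)"
    by (auto simp: colored_parts_def)
  then have "2 * Suc (length ps) \<le> fst p * prod_list (map fst ps)"
    by (intro mult_le_mono) auto
  then show ?case by simp
qed simp

lemma finite_ordered_colored_factorizations:
  "finite (ordered_colored_factorizations l n)"
proof (rule finite_subset)
  show "ordered_colored_factorizations l n \<subseteq>
          {ps. set ps \<subseteq> {..n} \<times> {1..l} \<and> length ps \<le> n}"
  proof
    fix ps assume "ps \<in> ordered_colored_factorizations l n"
    then have ps: "set ps \<subseteq> colored_parts l" "prod_list (map fst ps) = n"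
      by (auto simp: ordered_colored_factorizations_def)
    have len: "length ps < n"
      using length_less_prod_list[OF ps(1)] ps(2) by simp
    have "p \<in> {..n} \<times> {1..l}" if "p \<in> set ps" for p
    proof -
      have "fst p dvd n"
        using that ps(2) prod_list_dvd[of "fst p" "map fst ps"] by auto
      then have "fst p \<le> n" using len by (intro dvd_imp_le) auto
      then show ?thesis using that ps(1) by (auto simp: colored_parts_def)
    qed
    then show "ps \<in> {ps. set ps \<subseteq> {..n} \<times> {1..l} \<and> length ps \<le> n}"
      using len by auto
  qed
  show "finite {ps. set ps \<subseteq> {..n} \<times> {1..l} \<and> length ps \<le> n}"
    by (rule finite_lists_length_le) auto
qed

lemma num_colored_factorizations_1: "num_colored_factorizations l 1 = 1"
proof -
  have "ps = []" if "set ps \<subseteq> colored_parts l" "prod_list (map fst ps) = 1" for ps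
    using length_less_prod_list[OF that(1)] that(2) by simp
  then have "ordered_colored_factorizations l 1 = {[]}"
    by (auto simp: ordered_colored_factorizations_def)
  then show ?thesis by (simp add: num_colored_factorizations_def)
qed

text \<open>
  The Riemann zeta function on the real half-line \<open>s > 1\<close>, where its Dirichlet series
  converges. For \<open>s \<le> 1\<close> the value is unspecified; only arguments \<open>s > 1\<close> are used below.
\<close>

definition zeta :: "real \<Rightarrow> real" where
  "zeta s = (\<Sum>n. 1 / real (Suc n) powr s)"

text \<open>Meaningful for \<open>y > 1\<close> only.\<close>

definition zeta_inv :: "real \<Rightarrow> real" where
  "zeta_inv y = (THE s. s > 1 \<and> zeta s = y)"

definition beta :: "nat \<Rightarrow> real" where
  "beta l = zeta_inv ((real l + 1) / real l)"

definition alpha :: "nat \<Rightarrow> real" where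
  "alpha l = - (1 / (real l * beta l * deriv zeta (beta l)))"

end

theory Submission
  imports Defs
begin

text \<open>
  Let \<open>S x\<close> be the number of ordered \<open>l\<close>-colored factorizations of the integers up to \<open>x\<close>. Splitting
  off the first part gives \<open>S x = 1 + l * (\<Sum>d\<ge>2. S (x / d))\<close> for \<open>x \<ge> 1\<close>
  (\<open>weighted_count_recursion\<close>). With \<open>\<beta> = beta l\<close>, the weights \<open>p d = l * d powr -\<beta>\<close> sum to
  \<open>l * (zeta \<beta> - 1) = 1\<close>, so \<open>Z x = x powr -\<beta> * S x\<close> satisfies the renewal equation
  \<open>Z x = x powr -\<beta> + (\<Sum>d\<ge>2. p d * Z (x / d))\<close>, with steps \<open>ln d\<close> in the variable \<open>ln x\<close>. The claim is
  that \<open>Z\<close> tends to \<open>1 / (\<beta> * \<mu>)\<close>, where \<open>\<mu> = (\<Sum>d\<ge>2. p d * ln d) = - l * deriv zeta \<beta>\<close> is the mean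
  step. This is an instance of the renewal theorem, and two facts give it a short elementary proof.

  The first is a conservation law (\<open>log_integral_balance\<close>). If \<open>G\<close> denotes the integral of
  \<open>Z u / u\<close> from \<open>0\<close> to \<open>x\<close>, then \<open>(\<Sum>d\<ge>2. p d * (G x - G (x / d))) = (1 - x powr -\<beta>) / \<beta>\<close>. It
  bounds \<open>Z\<close>, and if \<open>Z\<close> is nearly constant over a long range below \<open>x\<close>, with value \<open>M\<close>, it yields
  \<open>M * \<mu> = 1 / \<beta>\<close> (\<open>constant_profile_value\<close>).

  The second is a maximum principle (\<open>extremal_limit_propagates\<close>). Along a sequence \<open>X n\<close> on which
  \<open>Z\<close> tends to its upper limit \<open>M\<close>, the renewal equation presents \<open>Z (X n)\<close> as an average of values
  that asymptotically do not exceed \<open>M\<close>; hence \<open>Z (X n / d)\<close> tends to \<open>M\<close> for every integer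
  \<open>d \<ge> 1\<close>. Consecutive large integers have ratio close to \<open>1\<close> and \<open>S\<close> is monotone, so \<open>Z\<close> is indeed
  nearly constant, equal to \<open>M\<close>, on \<open>[X n / (N * d), X n / N]\<close> once \<open>N\<close> is large. The density of the
  integers on the logarithmic scale thus replaces the usual non-lattice condition. The same holds for
  the lower limit, so both limits have the value that the conservation law prescribes.
\<close>

section \<open>The zeta function on the half-line above 1\<close>

lemma summable_zeta: "s > 1 \<Longrightarrow> summable (\<lambda>n. 1 / real (Suc n) powr s)"
  using summable_real_powr_iff[of "-s"] summable_Suc_iff[of "\<lambda>n. real n powr (-s)"]
  by (simp add: powr_minus_divide)

lemma zeta_tail_sums:
  assumes "s > 1"
  shows "(\<lambda>k. real (k + 2) powr (-s)) sums (zeta s - 1)"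
proof -
  have "(\<lambda>k. 1 / real (Suc (Suc k)) powr s) sums (zeta s - 1)"
    using summable_sums[OF summable_zeta[OF assms]]
    by (subst sums_Suc_iff) (simp add: zeta_def)
  then show ?thesis by (simp add: powr_minus_divide)
qed

text \<open>
  A logarithm grows more slowly than any power, so half of the distance from \<open>s\<close> to \<open>1\<close> pays
  for it.
\<close>

lemma summable_ln_powr:
  assumes "s > 1"
  shows "summable (\<lambda>n. ln (real (Suc n)) * real (Suc n) powr (-s))"
proof (rule summable_comparison_test')
  define e where "e = (s - 1) / 2"
  have e: "e > 0" "s - e > 1" using assms by (auto simp: e_def field_simps)
  show "summable (\<lambda>n. 1 / e * (1 / real (Suc n) powr (s - e)))"
    using summable_zeta[OF e(2)] by (rule summable_mult)
  show "norm (ln (real (Suc n)) * real (Suc n) powr (-s)) \<le> 1 / e * (1 / real (Suc n) powr (s - e))"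
    for n
  proof -
    have "ln (real (Suc n)) * real (Suc n) powr (-s) \<le> (real (Suc n) powr e / e) * real (Suc n) powr (-s)"
      by (intro mult_right_mono ln_powr_bound) (use e in auto)
    also have "\<dots> = 1 / e * (1 / real (Suc n) powr (s - e))"
      by (simp add: powr_diff powr_minus_divide)
    finally show ?thesis by simp
  qed
qed

text \<open>
  On a half-line \<open>{a..}\<close> with \<open>1 < a < s\<close> the differentiated terms are dominated by their values
  at \<open>a\<close>, which form a convergent series; so termwise differentiation is legitimate.
\<close>

lemma zeta_has_derivative:
  assumes "s > 1"
  shows "(zeta has_field_derivative - (\<Sum>n. ln (real (Suc n)) * real (Suc n) powr (-s))) (at s)"
proof -
  define a where "a = (1 + s) / 2"
  have a: "1 < a" "a < s" using assms by (auto simp: a_def)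
  have "((\<lambda>x. \<Sum>n. 1 / real (Suc n) powr x) has_field_derivative
      (\<Sum>n. - (ln (real (Suc n)) * real (Suc n) powr (-s)))) (at s)"
  proof (rule has_field_derivative_series'(2))
    show "convex {a..}" "s \<in> {a..}" "s \<in> interior {a..}" using a by auto
    show "summable (\<lambda>n. 1 / real (Suc n) powr s)" using summable_zeta[OF assms] .
    show "((\<lambda>x. 1 / real (Suc n) powr x) has_field_derivative
        - (ln (real (Suc n)) * real (Suc n) powr (-x))) (at x within {a..})" for n x
    proof -
      have "((\<lambda>x. exp (- x * ln (real (Suc n)))) has_field_derivative
          - (ln (real (Suc n)) * exp (- x * ln (real (Suc n))))) (at x within {a..})"
        by (auto intro!: derivative_eq_intros)
      then show ?thesis by (simp add: powr_def exp_minus inverse_eq_divide)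
    qed
    show "uniformly_convergent_on {a..}
        (\<lambda>n x. \<Sum>i<n. - (ln (real (Suc i)) * real (Suc i) powr (-x)))"
      by (rule Weierstrass_m_test'[OF _ summable_ln_powr[OF a(1)]])
        (auto simp: abs_mult intro!: mult_left_mono powr_mono)
  qed
  then show ?thesis
    by (simp only: zeta_def[abs_def] suminf_minus[OF summable_ln_powr[OF assms]])
qed

lemma ln_weighted_tail_sums:
  assumes "s > 1"
  shows "(\<lambda>k. ln (real (k + 2)) * real (k + 2) powr (-s)) sums (- deriv zeta s)"
proof -
  have "(\<lambda>k. ln (real (Suc (Suc k))) * real (Suc (Suc k)) powr (-s)) sums (- deriv zeta s)"
    using summable_sums[OF summable_ln_powr[OF assms]] DERIV_imp_deriv[OF zeta_has_derivative[OF assms]]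
    by (subst sums_Suc_iff) simp
  then show ?thesis by simp
qed

lemma zeta_strict_antimono:
  assumes "1 < s" "s < t"
  shows "zeta t < zeta s"
proof -
  have "(\<lambda>k. real (k + 2) powr (-s) - real (k + 2) powr (-t)) sums ((zeta s - 1) - (zeta t - 1))"
    by (intro sums_diff zeta_tail_sums) (use assms in auto)
  moreover have "0 < real (k + 2) powr (-s) - real (k + 2) powr (-t)" for k
    using assms by simp
  ultimately have "0 < (zeta s - 1) - (zeta t - 1)"
    using suminf_pos[of "\<lambda>k. real (k + 2) powr (-s) - real (k + 2) powr (-t)"]
    by (simp add: sums_iff)
  then show ?thesis by simp
qed

text \<open>
  Near \<open>1\<close> a long partial sum of the series is close to a partial sum of the harmonic series,
  which diverges.
\<close>

lemma zeta_takes_large_values: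
  shows "\<exists>s>1. y \<le> zeta s"
proof -
  have "\<exists>N. \<not> (\<Sum>n<N. inverse (real (Suc n))) \<le> y"
  proof (rule ccontr)
    assume "\<not> ?thesis"
    then have "summable (\<lambda>n. inverse (real (Suc n)))"
      by (intro summableI_nonneg_bounded[where x = y]) auto
    then show False using not_summable_harmonic[where 'a = real] summable_Suc_iff[of "\<lambda>n. inverse (real n)"] by simp
  qed
  then obtain N where N: "y < (\<Sum>n<N. 1 / real (Suc n) powr 1)"
    by (auto simp: not_le inverse_eq_divide)
  have "((\<lambda>s. \<Sum>n<N. 1 / real (Suc n) powr s) \<longlongrightarrow> (\<Sum>n<N. 1 / real (Suc n) powr 1)) (at_right 1)"
    by (intro tendsto_intros) auto
  then have "eventually (\<lambda>s. y < (\<Sum>n<N. 1 / real (Suc n) powr s)) (at_right 1)"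
    using N by (rule order_tendstoD)
  then have "eventually (\<lambda>s. y < (\<Sum>n<N. 1 / real (Suc n) powr s) \<and> 1 < s) (at_right (1::real))"
    using eventually_at_right_less by (rule eventually_conj)
  then obtain s where s: "y < (\<Sum>n<N. 1 / real (Suc n) powr s)" "1 < s"
    using eventually_happens'[OF trivial_limit_at_right_real] by blast
  have "(\<Sum>n<N. 1 / real (Suc n) powr s) \<le> zeta s"
    unfolding zeta_def by (intro sum_le_suminf summable_zeta s) auto
  then show ?thesis using s by (intro exI[of _ s]) linarith
qed

text \<open>
  Adding \<open>m\<close> to the argument multiplies each term of index at least \<open>2\<close> by at most \<open>(1/2) ^ m\<close>.
\<close>

lemma zeta_takes_values_near_1:
  assumes "y > 1"
  shows "\<exists>s>1. zeta s \<le> y"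
proof -
  have tail: "zeta (2 + real m) - 1 \<le> (1/2) ^ m * (zeta 2 - 1)" for m
  proof (rule sums_le)
    show "(\<lambda>k. real (k + 2) powr - (2 + real m)) sums (zeta (2 + real m) - 1)"
      by (rule zeta_tail_sums) simp
    show "(\<lambda>k. (1/2) ^ m * real (k + 2) powr - 2) sums ((1/2) ^ m * (zeta 2 - 1))"
      by (intro sums_mult zeta_tail_sums) simp
    show "real (k + 2) powr - (2 + real m) \<le> (1/2) ^ m * real (k + 2) powr - 2" for k
    proof -
      have "real (k + 2) powr (- real m) \<le> 2 powr (- real m)"
        by (rule powr_mono2') auto
      also have "\<dots> = (1/2) ^ m"
        by (simp add: powr_minus powr_realpow power_one_over inverse_eq_divide)
      finally show ?thesis
        by (simp only: minus_add_distrib powr_add) (simp add: mult.commute mult_right_mono)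
    qed
  qed
  have "(\<lambda>m. (1/2) ^ m * (zeta 2 - 1)) \<longlonglongrightarrow> 0 * (zeta 2 - 1)"
    by (intro tendsto_intros LIMSEQ_realpow_zero) auto
  then have "eventually (\<lambda>m. (1/2) ^ m * (zeta 2 - 1) < y - 1) sequentially"
    using assms by (intro order_tendstoD(2)) auto
  then obtain m :: nat where "(1/2) ^ m * (zeta 2 - 1) < y - 1"
    using eventually_happens'[OF sequentially_bot] by blast
  with tail[of m] show ?thesis by (intro exI[of _ "2 + real m"]) auto
qed

lemma zeta_inv_works:
  assumes "y > 1"
  shows "zeta_inv y > 1" "zeta (zeta_inv y) = y"
proof -
  obtain a where a: "a > 1" "y \<le> zeta a" using zeta_takes_large_values by blast
  obtain b where b: "b > 1" "zeta b \<le> y" using zeta_takes_values_near_1[OF assms] by blast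
  have "a \<le> b"
    using zeta_strict_antimono[of b a] a b by (cases "a \<le> b") auto
  have "continuous_on {a..b} zeta"
    using a by (intro DERIV_continuous_on[OF DERIV_subset[OF zeta_has_derivative]]) auto
  then obtain s where s: "a \<le> s" "s \<le> b" "zeta s = y"
    using IVT2'[of zeta b y a] a b \<open>a \<le> b\<close> by auto
  have "\<exists>!s. s > 1 \<and> zeta s = y"
  proof (rule ex1I[of _ s])
    show "t = s" if "t > 1 \<and> zeta t = y" for t
      using zeta_strict_antimono[of s t] zeta_strict_antimono[of t s] that s a
      by (cases s t rule: linorder_cases) auto
  qed (use s a in auto)
  from theI'[OF this] show "zeta_inv y > 1" "zeta (zeta_inv y) = y"
    by (auto simp: zeta_inv_def)
qed

section \<open>Splitting off the first part\<close>

text \<open>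
  Two exponents matter below: \<open>c = 0\<close> gives the plain summatory function, and \<open>c = beta l\<close> gives the
  partial sums of the Dirichlet series at its abscissa of convergence.
\<close>

definition weighted_count :: "nat \<Rightarrow> real \<Rightarrow> real \<Rightarrow> real" where
  "weighted_count l c x =
     (\<Sum>n | 1 \<le> n \<and> real n \<le> x. real (num_colored_factorizations l n) * real n powr (-c))"

lemma finite_nats_upto_real: "finite {n. 1 \<le> n \<and> real n \<le> x}"
  by (rule finite_subset[of _ "{..nat \<lfloor>x\<rfloor>}"]) (auto simp: le_nat_floor)

definition factorizations_upto :: "nat \<Rightarrow> real \<Rightarrow> (nat \<times> nat) list set" where
  "factorizations_upto l x = {ps. set ps \<subseteq> colored_parts l \<and> real (prod_list (map fst ps)) \<le> x}"

lemma factorizations_upto_UN: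
  "factorizations_upto l x = (\<Union>n\<in>{n. 1 \<le> n \<and> real n \<le> x}. ordered_colored_factorizations l n)"
  using length_less_prod_list
  by (fastforce simp: factorizations_upto_def ordered_colored_factorizations_def)

lemma finite_factorizations_upto: "finite (factorizations_upto l x)"
  unfolding factorizations_upto_UN
  by (intro finite_UN_I finite_nats_upto_real finite_ordered_colored_factorizations)

lemma weighted_count_altdef:
  "weighted_count l c x = (\<Sum>ps\<in>factorizations_upto l x. real (prod_list (map fst ps)) powr (-c))"
proof -
  have "(\<Sum>ps\<in>factorizations_upto l x. real (prod_list (map fst ps)) powr (-c)) =
      (\<Sum>n | 1 \<le> n \<and> real n \<le> x. \<Sum>ps\<in>ordered_colored_factorizations l n.
         real (prod_list (map fst ps)) powr (-c))"
    unfolding factorizations_upto_UN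
    by (intro sum.UNION_disjoint finite_nats_upto_real)
       (auto simp: finite_ordered_colored_factorizations, auto simp: ordered_colored_factorizations_def)
  also have "\<dots> = weighted_count l c x"
    unfolding weighted_count_def num_colored_factorizations_def
    by (intro sum.cong refl) (simp add: ordered_colored_factorizations_def)
  finally show ?thesis ..
qed

lemma weighted_count_eq_0: "x < 1 \<Longrightarrow> weighted_count l c x = 0"
  by (auto simp: weighted_count_def intro!: sum.neutral)

lemma factorizations_upto_split:
  assumes "x \<ge> 1"
  shows "factorizations_upto l x = insert [] ((\<lambda>(k, c, ps). (k + 2, c) # ps) `
           (SIGMA k:{k. real (k + 2) \<le> x}. {1..l} \<times> factorizations_upto l (x / real (k + 2))))"
    (is "_ = insert [] (?cons ` ?S)")
proof (intro equalityI subsetI)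
  fix ps assume ps: "ps \<in> factorizations_upto l x"
  show "ps \<in> insert [] (?cons ` ?S)"
  proof (cases ps)
    case (Cons p qs)
    obtain d c where p: "p = (d, c)" by force
    have d: "2 \<le> d" "c \<in> {1..l}" and qs: "set qs \<subseteq> colored_parts l"
      using ps Cons p by (auto simp: factorizations_upto_def colored_parts_def)
    have le: "real d * real (prod_list (map fst qs)) \<le> x"
      using ps Cons p by (simp add: factorizations_upto_def)
    have "1 \<le> real (prod_list (map fst qs))"
      using length_less_prod_list[OF qs] by simp
    then have "real d * 1 \<le> real d * real (prod_list (map fst qs))"
      by (intro mult_left_mono) auto
    then have "real d \<le> x" using le by linarith
    then have "(d - 2, c, qs) \<in> ?S"
      using d qs le by (auto simp: factorizations_upto_def field_simps)
    moreover have "ps = ?cons (d - 2, c, qs)" using Cons p d by simp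
    ultimately show ?thesis by blast
  qed auto
next
  fix ps assume "ps \<in> insert [] (?cons ` ?S)"
  then show "ps \<in> factorizations_upto l x"
    using assms by (auto simp: factorizations_upto_def colored_parts_def field_simps)
qed

text \<open>
  A nonempty factorization is a first part \<open>(k + 2, a)\<close> followed by a factorization of what is
  left, and the weight \<open>n powr (-c)\<close> is multiplicative. The series is a finite sum in disguise: its
  terms vanish as soon as \<open>k + 2 > x\<close>.
\<close>

lemma weighted_count_recursion:
  assumes "x \<ge> 1"
  shows "(\<lambda>k. real l * real (k + 2) powr (-c) * weighted_count l c (x / real (k + 2))) sums
           (weighted_count l c x - 1)"
proof -
  define K where "K = {k. real (k + 2) \<le> x}"
  define S where "S = (SIGMA k:K. {1..l} \<times> factorizations_upto l (x / real (k + 2)))"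
  define cons :: "nat \<times> nat \<times> (nat \<times> nat) list \<Rightarrow> (nat \<times> nat) list"
    where "cons = (\<lambda>(k, c, ps). (k + 2, c) # ps)"
  define w where "w ps = real (prod_list (map fst ps)) powr (-c)" for ps :: "(nat \<times> nat) list"
  have K: "finite K"
    by (rule finite_subset[of _ "{..nat \<lfloor>x\<rfloor>}"]) (auto simp: K_def intro!: le_nat_floor)
  have S: "finite S"
    unfolding S_def by (intro finite_SigmaI K finite_cartesian_product finite_factorizations_upto) auto
  have inj: "inj_on cons S" by (auto simp: inj_on_def cons_def)
  have w_cons: "w (cons (k, a, ps)) = real (k + 2) powr (-c) * w ps" for k a ps
    unfolding w_def cons_def prod.case list.map fst_conv prod_list.Cons of_nat_mult
    by (rule powr_mult)
  have "weighted_count l c x = (\<Sum>ps\<in>insert [] (cons ` S). w ps)"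
    unfolding weighted_count_altdef w_def S_def K_def cons_def
    by (simp only: factorizations_upto_split[OF assms])
  also have "\<dots> = 1 + (\<Sum>t\<in>S. w (cons t))"
    using S inj by (subst sum.insert) (auto simp: w_def sum.reindex cons_def)
  also have "(\<Sum>t\<in>S. w (cons t)) =
      (\<Sum>k\<in>K. \<Sum>t\<in>{1..l} \<times> factorizations_upto l (x / real (k + 2)). w (cons (k, t)))"
    unfolding S_def by (subst sum.Sigma) (auto simp: K finite_factorizations_upto)
  also have "\<dots> = (\<Sum>k\<in>K. \<Sum>_\<in>{1..l}. \<Sum>ps\<in>factorizations_upto l (x / real (k + 2)).
      real (k + 2) powr (-c) * w ps)"
    unfolding sum.cartesian_product
    by (intro sum.cong refl) (auto simp: w_cons simp del: of_nat_add)
  also have "\<dots> = (\<Sum>k\<in>K. real l * real (k + 2) powr (-c) * weighted_count l c (x / real (k + 2)))"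
    unfolding weighted_count_altdef w_def by (simp add: sum_distrib_left mult.assoc)
  finally have "weighted_count l c x - 1 =
      (\<Sum>k\<in>K. real l * real (k + 2) powr (-c) * weighted_count l c (x / real (k + 2)))" by simp
  moreover have "(\<lambda>k. real l * real (k + 2) powr (-c) * weighted_count l c (x / real (k + 2))) sums
      (\<Sum>k\<in>K. real l * real (k + 2) powr (-c) * weighted_count l c (x / real (k + 2)))"
    by (rule sums_finite[OF K]) (auto simp: K_def weighted_count_eq_0)
  ultimately show ?thesis by simp
qed

section \<open>Upper limits and averages\<close>

text \<open>
  The suprema over \<open>[n, \<infinity>)\<close> decrease to the upper limit, and \<open>X n\<close> is a point beyond \<open>n\<close> where the
  function comes within \<open>1 / (n + 1)\<close> of the supremum.
\<close>

lemma limsup_along_sequence: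
  fixes f :: "real \<Rightarrow> real"
  assumes bd: "\<And>x. \<bar>f x\<bar> \<le> B"
  obtains M X where "filterlim X at_top sequentially" "(\<lambda>n. f (X n)) \<longlonglongrightarrow> M"
    "\<forall>\<epsilon>>0. eventually (\<lambda>x. f x < M + \<epsilon>) at_top"
proof -
  define S where "S n = (SUP x\<in>{real n..}. f x)" for n
  have f_le: "f x \<le> B" "- B \<le> f x" for x using bd[of x] by auto
  have bdd: "bdd_above (f ` A)" for A using f_le by (auto simp: bdd_above_def)
  have S_ge: "f x \<le> S n" if "real n \<le> x" for x n
    unfolding S_def using that by (intro cSUP_upper bdd) auto
  have "decseq S"
    unfolding decseq_def S_def by (auto intro!: cSUP_subset_mono bdd)
  moreover have "- B \<le> S n" for n using S_ge[of n "real n"] f_le[of "real n"] by simp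
  ultimately obtain M where M: "S \<longlonglongrightarrow> M" "\<And>n. M \<le> S n"
    using decseq_convergent by metis
  have "\<exists>x\<ge>real n. S n - 1 / real (Suc n) < f x" for n
  proof -
    have "S n - 1 / real (Suc n) < (SUP x\<in>{real n..}. f x)" by (simp add: S_def)
    then show ?thesis by (subst (asm) less_cSUP_iff) (auto intro: bdd)
  qed
  then obtain X where X: "\<And>n. real n \<le> X n" "\<And>n. S n - 1 / real (Suc n) < f (X n)" by metis
  show thesis
  proof
    show "filterlim X at_top sequentially"
      by (rule filterlim_at_top_mono[OF filterlim_real_sequentially]) (simp add: X)
    have "(\<lambda>n. S n - 1 / real (Suc n)) \<longlonglongrightarrow> M - 0"
      by (intro tendsto_diff M) (rule LIMSEQ_Suc[OF lim_1_over_n])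
    then have "(\<lambda>n. S n - 1 / real (Suc n)) \<longlonglongrightarrow> M" by simp
    then show "(\<lambda>n. f (X n)) \<longlonglongrightarrow> M"
      using M(1)
      by (rule tendsto_sandwich[rotated 2])
         (intro always_eventually allI less_imp_le[OF X(2)] S_ge X(1))+
  next
    have "eventually (\<lambda>x. f x < M + \<epsilon>) at_top" if "\<epsilon> > 0" for \<epsilon>
    proof -
      have "eventually (\<lambda>n. S n < M + \<epsilon>) sequentially"
        using that by (intro order_tendstoD(2)[OF M(1)]) simp
      then obtain n where "S n < M + \<epsilon>" using eventually_happens'[OF sequentially_bot] by blast
      then show ?thesis
        using S_ge[of n] by (intro eventually_mono[OF eventually_ge_at_top[of "real n"]]) fastforce
    qed
    then show "\<forall>\<epsilon>>0. eventually (\<lambda>x. f x < M + \<epsilon>) at_top" by blast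
  qed
qed

text \<open>
  The maximum principle behind the renewal theorem. Up to the vanishing error \<open>e\<close>, the value
  \<open>f (X n)\<close> is an average of the values \<open>f (X n / (k + 2))\<close> with positive weights. None of these can
  asymptotically exceed the upper limit \<open>M\<close>, so an average that tends to \<open>M\<close> forces every one of them
  to tend to \<open>M\<close>. Since \<open>k + 2\<close> runs through all integers from \<open>2\<close> on, one step reaches every \<open>d\<close>.
\<close>

lemma extremal_limit_propagates:
  fixes f :: "real \<Rightarrow> real" and p :: "nat \<Rightarrow> real"
  assumes p: "\<And>k. p k > 0" "p sums 1"
    and bd: "\<And>x. \<bar>f x\<bar> \<le> B"
    and renewal: "\<And>x. x \<ge> 1 \<Longrightarrow> (\<lambda>k. p k * f (x / real (k + 2))) sums (f x - e x)"
    and e: "(e \<longlongrightarrow> 0) at_top"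
    and X: "filterlim X at_top sequentially"
    and fX: "(\<lambda>n. f (X n)) \<longlonglongrightarrow> M"
    and limsup: "\<And>\<epsilon>. \<epsilon> > 0 \<Longrightarrow> eventually (\<lambda>x. f x < M + \<epsilon>) at_top"
    and d: "d \<ge> 1"
  shows "(\<lambda>n. f (X n / real d)) \<longlonglongrightarrow> M"
proof (cases "d = 1")
  case False
  define j where "j = d - 2"
  have j: "d = j + 2" using d False by (simp add: j_def)
  have Xd: "filterlim (\<lambda>n. X n / real (k + 2)) at_top sequentially" for k
    using filterlim_tendsto_pos_mult_at_top[OF tendsto_const _ X, of "1 / real (k + 2)"] by simp
  \<comment> \<open>Truncating from below at \<open>M\<close> makes every term converge, so the sum and the limit can be interchanged.\<close>
  define g where "g x = max (f x) M" for x
  have gM: "(\<lambda>n. g (X n / real (k + 2))) \<longlonglongrightarrow> M" for k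
  proof (rule order_tendstoI)
    fix a assume "a < M"
    then show "eventually (\<lambda>n. a < g (X n / real (k + 2))) sequentially"
      by (intro always_eventually) (auto simp: g_def)
  next
    fix a assume a: "M < a"
    then have "eventually (\<lambda>x. f x < M + (a - M)) at_top" by (intro limsup) simp
    then have "eventually (\<lambda>n. f (X n / real (k + 2)) < M + (a - M)) sequentially"
      by (rule eventually_compose_filterlim[OF _ Xd])
    then show "eventually (\<lambda>n. g (X n / real (k + 2)) < a) sequentially"
      by eventually_elim (use a in \<open>simp add: g_def\<close>)
  qed
  have g_bd: "\<bar>g x\<bar> \<le> \<bar>B\<bar> + \<bar>M\<bar>" for x using bd[of x] by (auto simp: g_def)
  have sum_g: "(\<lambda>n. \<Sum>k. p k * g (X n / real (k + 2))) \<longlonglongrightarrow> (\<Sum>k. p k * M)"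
    and summ_g: "eventually (\<lambda>n. summable (\<lambda>k. norm (p k * g (X n / real (k + 2))))) sequentially"
  proof -
    have "summable (\<lambda>k. p k * (\<bar>B\<bar> + \<bar>M\<bar>))" using p(2) by (intro summable_mult2) (simp add: sums_iff)
    moreover have "eventually (\<lambda>(k, n). norm (p k * g (X n / real (k + 2))) \<le> p k * (\<bar>B\<bar> + \<bar>M\<bar>))
        (at_top \<times>\<^sub>F sequentially)"
      using g_bd by (intro always_eventually)
        (auto simp: abs_mult abs_of_pos[OF p(1)] p(1) less_imp_le intro!: mult_left_mono)
    ultimately have "eventually (\<lambda>n. summable (\<lambda>k. norm (p k * g (X n / real (k + 2))))) sequentially \<and>
        summable (\<lambda>k. norm (p k * M)) \<and>
        (\<lambda>n. \<Sum>k. p k * g (X n / real (k + 2))) \<longlonglongrightarrow> (\<Sum>k. p k * M)"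
      by (intro tannerys_theorem[OF tendsto_mult_left[OF gM]]) auto
    then show "(\<lambda>n. \<Sum>k. p k * g (X n / real (k + 2))) \<longlonglongrightarrow> (\<Sum>k. p k * M)"
      "eventually (\<lambda>n. summable (\<lambda>k. norm (p k * g (X n / real (k + 2))))) sequentially" by blast+
  qed
  have "(\<lambda>n. e (X n)) \<longlonglongrightarrow> 0" using e X by (rule filterlim_compose)
  with sum_g fX have "(\<lambda>n. (\<Sum>k. p k * g (X n / real (k + 2))) - (f (X n) - e (X n)))
      \<longlonglongrightarrow> (\<Sum>k. p k * M) - (M - 0)"
    by (intro tendsto_intros)
  moreover have "(\<Sum>k. p k * M) = M"
    using sums_mult2[OF p(2), of M] by (simp add: sums_iff)
  ultimately have lim0: "(\<lambda>n. (\<Sum>k. p k * g (X n / real (k + 2))) - (f (X n) - e (X n))) \<longlonglongrightarrow> 0"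
    by simp
  \<comment> \<open>\<open>g - f\<close> is nonnegative, so its average, which tends to \<open>0\<close>, bounds each single term.\<close>
  have term_le: "eventually (\<lambda>n. p j * (g (X n / real d) - f (X n / real d)) \<le>
      (\<Sum>k. p k * g (X n / real (k + 2))) - (f (X n) - e (X n))) sequentially"
    using summ_g X[unfolded filterlim_at_top, rule_format, of 1]
  proof eventually_elim
    case (elim n)
    have "(\<lambda>k. p k * g (X n / real (k + 2)) - p k * f (X n / real (k + 2))) sums
        ((\<Sum>k. p k * g (X n / real (k + 2))) - (f (X n) - e (X n)))"
      by (intro sums_diff renewal[OF elim(2)] summable_sums summable_norm_cancel[OF elim(1)])
    moreover have "0 \<le> p k * g (X n / real (k + 2)) - p k * f (X n / real (k + 2))" for k
      using p(1)[of k] by (simp add: g_def)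
    ultimately have "p j * g (X n / real (j + 2)) - p j * f (X n / real (j + 2)) \<le>
        (\<Sum>k. p k * g (X n / real (k + 2))) - (f (X n) - e (X n))"
      using sum_le_suminf[of "\<lambda>k. p k * g (X n / real (k + 2)) - p k * f (X n / real (k + 2))" "{j}"]
      by (simp add: sums_iff)
    then show ?case by (simp add: j right_diff_distrib)
  qed
  have "(\<lambda>n. p j * (g (X n / real d) - f (X n / real d))) \<longlonglongrightarrow> 0"
    by (rule tendsto_sandwich[OF _ term_le tendsto_const lim0])
       (use p(1)[of j] in \<open>auto intro!: always_eventually simp: g_def\<close>)
  from tendsto_mult_left[OF this, of "1 / p j"]
  have "(\<lambda>n. g (X n / real d) - f (X n / real d)) \<longlonglongrightarrow> 0" using p(1)[of j] by simp
  from tendsto_diff[OF gM[of j] this] show ?thesis by (simp add: j)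
qed (use fX in simp)

section \<open>Cutting an interval at the points with integer ratios\<close>

text \<open>
  This is \<open>exp u - 1 \<le> u * exp u\<close> for \<open>u = b * ln t\<close>. It is used both for \<open>t \<ge> 1\<close> and, as a lower
  bound of \<open>1 - t powr b\<close>, for \<open>t \<le> 1\<close>.
\<close>

lemma powr_minus_1_le:
  fixes t b :: real
  assumes "t > 0"
  shows "t powr b - 1 \<le> b * ln t * t powr b"
proof -
  have "(1 + - (b * ln t)) * t powr b \<le> exp (- (b * ln t)) * t powr b"
    using exp_ge_add_one_self[of "- (b * ln t)"] by (intro mult_right_mono) auto
  also have "\<dots> = 1" using assms by (simp add: powr_def flip: exp_add)
  finally show ?thesis by (simp add: algebra_simps)
qed

text \<open>
  The interval \<open>[x / (N * d), x / N]\<close> is cut at the points \<open>x / j\<close>. These points are the only places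
  where the limit of \<open>normalized_count\<close> along a sequence is known, and for large \<open>N\<close> the ratios
  \<open>(j + 1) / j\<close> of neighbouring ones are uniformly close to \<open>1\<close>.
\<close>

lemma telescope_over_ratios:
  fixes f :: "real \<Rightarrow> real"
  assumes "d \<ge> 1"
  shows "(\<Sum>j\<in>{N..<N * d}. f (x / real j) - f (x / real (j + 1))) = f (x / real N) - f (x / real (N * d))"
  using sum_Suc_diff'[of N "N * d" "\<lambda>j. - f (x / real j)"] assms by simp

lemma sum_ln_ratios:
  assumes "N \<ge> 1" "d \<ge> 1"
  shows "(\<Sum>j\<in>{N..<N * d}. ln (real (j + 1) / real j)) = ln (real d)"
proof -
  have "(\<Sum>j\<in>{N..<N * d}. ln (real (j + 1) / real j)) = (\<Sum>j\<in>{N..<N * d}. ln (real (Suc j)) - ln (real j))"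
    using assms by (intro sum.cong refl) (auto simp: ln_div)
  also have "\<dots> = ln (real (N * d)) - ln (real N)"
    using assms by (intro sum_Suc_diff') auto
  also have "\<dots> = ln (real d)" using assms by (simp add: ln_mult)
  finally show ?thesis .
qed

section \<open>The renewal equation and its conservation law\<close>

text \<open>
  In the variable \<open>ln x\<close> the recursion is a renewal equation with steps \<open>ln (k + 2)\<close>. The exponent
  \<open>beta l\<close> is the one for which the weights below form a probability distribution; then
  \<open>mean_log_step\<close> is the mean step (\<open>mean_log_step_sums\<close>).
\<close>

definition step_weight :: "nat \<Rightarrow> nat \<Rightarrow> real" where
  "step_weight l k = real l * real (k + 2) powr (- beta l)"

definition mean_log_step :: "nat \<Rightarrow> real" where
  "mean_log_step l = - (real l * deriv zeta (beta l))"

definition normalized_count :: "nat \<Rightarrow> real \<Rightarrow> real" where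
  "normalized_count l x = x powr (- beta l) * weighted_count l 0 x"

text \<open>
  This is the integral of \<open>normalized_count l u / u\<close> over \<open>u\<close> from \<open>0\<close> to \<open>x\<close>, in the closed form that
  partial summation gives; see \<open>log_integral_altdef\<close>.
\<close>

definition log_integral :: "nat \<Rightarrow> real \<Rightarrow> real" where
  "log_integral l x = (weighted_count l (beta l) x - normalized_count l x) / beta l"

context
  fixes l :: nat
  assumes l: "l \<ge> 1"
begin

lemma beta_gt_1: "beta l > 1"
  using l by (auto simp: beta_def field_simps intro!: zeta_inv_works)

lemma zeta_beta: "zeta (beta l) = 1 + 1 / real l"
  using zeta_inv_works(2)[of "(real l + 1) / real l"] l by (simp add: beta_def field_simps)

lemma step_weight_pos: "step_weight l k > 0"
  using l by (simp add: step_weight_def)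

lemma step_weight_sums: "step_weight l sums 1"
  using sums_mult[OF zeta_tail_sums[OF beta_gt_1], of "real l"] l
  by (simp add: step_weight_def[abs_def] zeta_beta)

lemma mean_log_step_sums: "(\<lambda>k. step_weight l k * ln (real (k + 2))) sums mean_log_step l"
  using sums_mult[OF ln_weighted_tail_sums[OF beta_gt_1], of "real l"]
  by (simp add: step_weight_def mean_log_step_def mult_ac)

lemma mean_log_step_pos: "mean_log_step l > 0"
  using suminf_pos[of "\<lambda>k. step_weight l k * ln (real (k + 2))"] mean_log_step_sums step_weight_pos
  by (simp add: sums_iff)

lemma normalized_count_nonneg: "normalized_count l x \<ge> 0"
  by (auto simp: normalized_count_def weighted_count_def intro!: mult_nonneg_nonneg sum_nonneg)

lemma normalized_count_eq_0: "x < 1 \<Longrightarrow> normalized_count l x = 0"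
  by (simp add: normalized_count_def weighted_count_eq_0)

lemma normalized_count_renewal:
  assumes "x \<ge> 1"
  shows "(\<lambda>k. step_weight l k * normalized_count l (x / real (k + 2))) sums
           (normalized_count l x - x powr (- beta l))"
proof -
  have "step_weight l k * normalized_count l (x / real (k + 2)) =
      x powr (- beta l) * (real l * real (k + 2) powr (-0) * weighted_count l 0 (x / real (k + 2)))" for k
  proof -
    have "x powr (- beta l) = real (k + 2) powr (- beta l) * (x / real (k + 2)) powr (- beta l)"
      by (subst powr_mult[symmetric]) auto
    then show ?thesis
      by (simp add: step_weight_def normalized_count_def)
  qed
  then show ?thesis
    using sums_mult[OF weighted_count_recursion[OF assms, of l 0], of "x powr (- beta l)"]
    by (simp only: normalized_count_def right_diff_distrib mult_1_right)
qed

text \<open>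
  The conservation law of the renewal equation: the integral of \<open>normalized_count\<close> over one step back
  from \<open>x\<close>, on the logarithmic scale and averaged over the steps, tends to \<open>1 / beta l\<close>. It comes from subtracting the recursions
  for the exponents \<open>0\<close> and \<open>beta l\<close>, whose inhomogeneous terms are \<open>x powr - beta l\<close> and \<open>1\<close>.
\<close>

lemma log_integral_balance:
  assumes "x \<ge> 1"
  shows "(\<lambda>k. step_weight l k * (log_integral l x - log_integral l (x / real (k + 2)))) sums
           ((1 - x powr (- beta l)) / beta l)"
proof -
  let ?T = "weighted_count l (beta l)" and ?Z = "normalized_count l"
  have T: "(\<lambda>k. step_weight l k * ?T (x / real (k + 2))) sums (?T x - 1)"
    using weighted_count_recursion[OF assms, of l "beta l"] by (simp add: step_weight_def)
  have "(\<lambda>k. (step_weight l k * (?T x - ?Z x) - (step_weight l k * ?T (x / real (k + 2)) -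
       step_weight l k * ?Z (x / real (k + 2)))) / beta l) sums
       ((1 * (?T x - ?Z x) - ((?T x - 1) - (?Z x - x powr (- beta l)))) / beta l)"
    by (intro sums_divide sums_diff sums_mult2 step_weight_sums T normalized_count_renewal assms)
  then show ?thesis
    by (simp add: log_integral_def algebra_simps diff_divide_distrib add_divide_distrib)
qed

lemma log_integral_altdef:
  "beta l * log_integral l x = (\<Sum>n | 1 \<le> n \<and> real n \<le> x.
     real (num_colored_factorizations l n) * (real n powr (- beta l) - x powr (- beta l)))"
proof -
  have "beta l * log_integral l x = weighted_count l (beta l) x - normalized_count l x"
    using beta_gt_1 by (simp add: log_integral_def)
  then show ?thesis
    by (simp add: weighted_count_def normalized_count_def right_diff_distrib
        sum_subtractf sum_distrib_left mult_ac)
qed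

text \<open>
  The summatory function is monotone. Hence on \<open>[y, x]\<close> the integrand \<open>normalized_count\<close>, taken with
  respect to the measure \<open>du / u\<close>, is up to the factor \<open>(x / y) powr beta l\<close>, at least its value at \<open>y\<close> and at most its value at \<open>x\<close>.
\<close>

lemma log_integral_increment:
  assumes "0 < y" "y \<le> x"
  shows log_integral_increment_ge: "normalized_count l y * (y / x) powr beta l * ln (x / y)
          \<le> log_integral l x - log_integral l y" (is ?lower)
    and log_integral_increment_le: "log_integral l x - log_integral l y
          \<le> normalized_count l x * (x / y) powr beta l * ln (x / y)" (is ?upper)
proof -
  define b where "b = beta l"
  define A where "A n = real (num_colored_factorizations l n)" for n
  define I where "I z = {n. 1 \<le> n \<and> real n \<le> z}" for z
  have b: "b > 0" using beta_gt_1 by (simp add: b_def)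
  have x: "x > 0" using assms by simp
  have fin: "finite (I z)" for z unfolding I_def by (rule finite_nats_upto_real)
  have sub: "I y \<subseteq> I x" using assms by (auto simp: I_def)
  have count: "weighted_count l 0 z = (\<Sum>n\<in>I z. A n)" for z
    unfolding weighted_count_def I_def A_def by (intro sum.cong) auto
  have count_nonneg: "weighted_count l 0 z \<ge> 0" for z by (simp add: count A_def sum_nonneg)
  have Gb: "b * log_integral l z = (\<Sum>n\<in>I z. A n * (real n powr (-b) - z powr (-b)))" for z
    using log_integral_altdef[of z] by (simp add: b_def A_def I_def)
  have dec: "v powr (-b) \<le> u powr (-b)" if "0 < u" "u \<le> v" for u v :: real
    using that b by (intro powr_mono2') auto
  \<comment> \<open>In the sum for the integral up to \<open>x\<close>, the terms with \<open>y < n \<le> x\<close> are nonnegative.\<close>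
  have "(\<Sum>n\<in>I y. A n * (real n powr (-b) - x powr (-b))) \<le> b * log_integral l x"
    unfolding Gb using dec
    by (intro sum_mono2 fin sub mult_nonneg_nonneg) (auto simp: A_def I_def)
  then have "weighted_count l 0 y * (y powr (-b) - x powr (-b)) \<le> b * log_integral l x - b * log_integral l y"
    unfolding Gb[of y] count sum_distrib_right
    by (simp add: algebra_simps sum_subtractf)
  moreover have "y powr (-b) * ((y / x) powr b * (b * ln (x / y))) \<le> y powr (-b) - x powr (-b)"
  proof -
    have "b * ln (x / y) * (y / x) powr b \<le> 1 - (y / x) powr b"
      using powr_minus_1_le[of "y / x" b] assms x by (simp add: ln_div algebra_simps)
    from mult_left_mono[OF this, of "y powr (-b)"] show ?thesis
      using assms x by (simp add: powr_divide powr_minus field_simps)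
  qed
  moreover note count_nonneg
  ultimately have "weighted_count l 0 y * (y powr (-b) * ((y / x) powr b * (b * ln (x / y)))) \<le>
      b * (log_integral l x - log_integral l y)"
    by (smt (verit) mult_left_mono right_diff_distrib)
  then have "b * (normalized_count l y * (y / x) powr b * ln (x / y)) \<le>
      b * (log_integral l x - log_integral l y)"
    by (simp add: normalized_count_def b_def mult_ac)
  then show ?lower using b by (simp add: b_def)
  \<comment> \<open>The integral up to \<open>y\<close> is a sum over \<open>n \<le> y\<close>; the terms \<open>y < n \<le> x\<close> would only decrease it.\<close>
  have "(\<Sum>n\<in>I x. A n * (y powr (-b) - real n powr (-b))) \<ge> (\<Sum>n\<in>I y. A n * (y powr (-b) - real n powr (-b)))"
    using dec assms
    by (intro sum_mono2 fin sub mult_nonneg_nonneg) (auto simp: A_def I_def)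
  then have "b * log_integral l x - b * log_integral l y \<le> weighted_count l 0 x * (y powr (-b) - x powr (-b))"
    unfolding Gb count sum_distrib_right
    by (simp add: algebra_simps sum_subtractf)
  moreover have "y powr (-b) - x powr (-b) \<le> x powr (-b) * ((x / y) powr b * (b * ln (x / y)))"
  proof -
    have "x powr (-b) * ((x / y) powr b - 1) \<le> x powr (-b) * (b * ln (x / y) * (x / y) powr b)"
      using powr_minus_1_le[of "x / y" b] assms x by (intro mult_left_mono) auto
    then show ?thesis
      using assms x by (simp add: powr_divide powr_minus field_simps)
  qed
  moreover note count_nonneg
  ultimately have "b * (log_integral l x - log_integral l y) \<le>
      weighted_count l 0 x * (x powr (-b) * ((x / y) powr b * (b * ln (x / y))))"
    by (smt (verit) mult_left_mono right_diff_distrib)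
  then have "b * (log_integral l x - log_integral l y) \<le>
      b * (normalized_count l x * (x / y) powr b * ln (x / y))"
    by (simp add: normalized_count_def b_def mult_ac)
  then show ?upper using b by (simp add: b_def)
qed

lemma log_integral_mono:
  assumes "0 < y" "y \<le> x"
  shows "log_integral l y \<le> log_integral l x"
proof -
  have "0 \<le> normalized_count l y * (y / x) powr beta l * ln (x / y)"
    using assms by (intro mult_nonneg_nonneg normalized_count_nonneg) auto
  then show ?thesis using log_integral_increment_ge[OF assms] by linarith
qed

text \<open>
  All terms in the conservation law are nonnegative and their sum is at most \<open>1 / beta l\<close>. The term of
  the part \<open>2\<close>, taken at \<open>2 * x\<close>, already controls \<open>normalized_count l x\<close>.
\<close>

lemma normalized_count_bounded: "\<exists>B. \<forall>x. \<bar>normalized_count l x\<bar> \<le> B"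
proof -
  define c where "c = step_weight l 0 * ((1/2) powr beta l * ln 2)"
  have c: "c > 0" using step_weight_pos by (simp add: c_def)
  have "\<bar>normalized_count l x\<bar> \<le> 1 / beta l / c" for x
  proof (cases "x \<ge> 1")
    case False
    then show ?thesis using c beta_gt_1 by (simp add: normalized_count_eq_0)
  next
    case True
    define y where "y = 2 * x"
    have y: "y \<ge> 1" "y > 0" "y / 2 = x" using True by (auto simp: y_def)
    have "0 \<le> step_weight l k * (log_integral l y - log_integral l (y / real (k + 2)))" for k
      using step_weight_pos[of k] y by (auto intro!: mult_nonneg_nonneg log_integral_mono simp: field_simps)
    then have "step_weight l 0 * (log_integral l y - log_integral l x) \<le> (1 - y powr (- beta l)) / beta l"
      using sum_le_suminf[of "\<lambda>k. step_weight l k * (log_integral l y - log_integral l (y / real (k + 2)))" "{0}"]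
        log_integral_balance[OF y(1)] y(3) by (simp add: sums_iff)
    also have "\<dots> \<le> 1 / beta l" using beta_gt_1 by (intro divide_right_mono) auto
    finally have "step_weight l 0 * (log_integral l y - log_integral l x) \<le> 1 / beta l" .
    moreover have "normalized_count l x * (1/2) powr beta l * ln 2 \<le> log_integral l y - log_integral l x"
      using log_integral_increment_ge[of x y] True by (simp add: y_def)
    ultimately have "c * normalized_count l x \<le> 1 / beta l"
      using mult_left_mono[of _ _ "step_weight l 0"] step_weight_pos[of 0]
      unfolding c_def by (smt (verit) mult.assoc mult.commute)
    then have "normalized_count l x \<le> 1 / beta l / c"
      unfolding pos_le_divide_eq[OF c] by (simp only: mult.commute)
    then show ?thesis using normalized_count_nonneg[of x] by simp
  qed
  then show ?thesis by blast
qed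

lemma log_integral_telescope_le:
  assumes "x > 0" "N \<ge> 1" "d \<ge> 1"
  shows "log_integral l (x / real N) - log_integral l (x / real (N * d)) \<le>
    (real (N + 1) / real N) powr beta l *
    (\<Sum>j\<in>{N..<N * d}. normalized_count l (x / real j) * ln (real (j + 1) / real j))"
  unfolding telescope_over_ratios[OF assms(3), symmetric] sum_distrib_left
proof (rule sum_mono)
  fix j assume j: "j \<in> {N..<N * d}"
  then have pos: "j > 0" "real N \<le> real j" "N > 0" using assms by auto
  have quot: "x / real j / (x / real (j + 1)) = real (j + 1) / real j"
    and le: "0 < x / real (j + 1)" "x / real (j + 1) \<le> x / real j"
    using pos assms by (auto intro!: divide_left_mono)
  have "log_integral l (x / real j) - log_integral l (x / real (j + 1)) \<le>
      normalized_count l (x / real j) * (real (j + 1) / real j) powr beta l * ln (real (j + 1) / real j)"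
    using log_integral_increment_le[OF le] by (simp only: quot)
  also have "\<dots> \<le> normalized_count l (x / real j) * (real (N + 1) / real N) powr beta l * ln (real (j + 1) / real j)"
    using pos beta_gt_1
    by (intro mult_right_mono mult_left_mono powr_mono2 normalized_count_nonneg) (auto simp: field_simps)
  finally show "log_integral l (x / real j) - log_integral l (x / real (j + 1)) \<le>
    (real (N + 1) / real N) powr beta l * (normalized_count l (x / real j) * ln (real (j + 1) / real j))"
    by (simp only: mult_ac)
qed

lemma log_integral_telescope_ge:
  assumes "x > 0" "N \<ge> 1" "d \<ge> 1"
  shows "(real N / real (N + 1)) powr beta l *
    (\<Sum>j\<in>{N..<N * d}. normalized_count l (x / real (j + 1)) * ln (real (j + 1) / real j)) \<le>
    log_integral l (x / real N) - log_integral l (x / real (N * d))"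
  unfolding telescope_over_ratios[OF assms(3), symmetric] sum_distrib_left
proof (rule sum_mono)
  fix j assume j: "j \<in> {N..<N * d}"
  then have pos: "j > 0" "real N \<le> real j" "N > 0" using assms by auto
  have quot: "x / real j / (x / real (j + 1)) = real (j + 1) / real j"
    "x / real (j + 1) / (x / real j) = real j / real (j + 1)"
    and le: "0 < x / real (j + 1)" "x / real (j + 1) \<le> x / real j"
    using pos assms by (auto intro!: divide_left_mono)
  have "normalized_count l (x / real (j + 1)) * (real N / real (N + 1)) powr beta l * ln (real (j + 1) / real j) \<le>
    normalized_count l (x / real (j + 1)) * (real j / real (j + 1)) powr beta l * ln (real (j + 1) / real j)"
    using pos beta_gt_1
    by (intro mult_right_mono mult_left_mono powr_mono2 normalized_count_nonneg) (auto simp: field_simps)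
  also have "\<dots> \<le> log_integral l (x / real j) - log_integral l (x / real (j + 1))"
    using log_integral_increment_ge[OF le] by (simp only: quot)
  finally show "(real N / real (N + 1)) powr beta l *
    (normalized_count l (x / real (j + 1)) * ln (real (j + 1) / real j)) \<le>
    log_integral l (x / real j) - log_integral l (x / real (j + 1))"
    by (simp only: mult_ac)
qed

section \<open>The limit of the normalized count\<close>

text \<open>
  The shift \<open>s\<close> is \<open>1\<close> for the lower and \<open>0\<close> for the upper Riemann sums of the integrals in
  the conservation law.
  The part \<open>k + 2\<close> contributes \<open>ln (k + 2)\<close> times a bounded quantity, and the mean step is finite; this
  dominates the series and permits taking the limit term by term.
\<close>

lemma log_averages_tendsto:
  fixes X :: "nat \<Rightarrow> real" and N s :: nat
  assumes lim: "\<And>d. d \<ge> 1 \<Longrightarrow> (\<lambda>n. normalized_count l (X n / real d)) \<longlonglongrightarrow> M"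
    and N: "N \<ge> 1"
  defines "avg \<equiv> (\<lambda>k n. step_weight l k *
      (\<Sum>j\<in>{N..<N * (k + 2)}. normalized_count l (X n / real (j + s)) * ln (real (j + 1) / real j)))"
  shows "summable (\<lambda>k. avg k n)" and "(\<lambda>n. \<Sum>k. avg k n) \<longlonglongrightarrow> M * mean_log_step l"
proof -
  obtain B where B: "\<And>x. \<bar>normalized_count l x\<bar> \<le> B" using normalized_count_bounded by blast
  define m where "m k = B * (step_weight l k * ln (real (k + 2)))" for k
  have summ: "summable m"
    unfolding m_def by (intro summable_mult sums_summable[OF mean_log_step_sums])
  have avg_le: "norm (avg k n) \<le> m k" for k n
  proof -
    have "\<bar>\<Sum>j\<in>{N..<N * (k + 2)}. normalized_count l (X n / real (j + s)) * ln (real (j + 1) / real j)\<bar>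
        \<le> (\<Sum>j\<in>{N..<N * (k + 2)}. B * ln (real (j + 1) / real j))"
    proof (rule order_trans[OF sum_abs sum_mono])
      fix j assume "j \<in> {N..<N * (k + 2)}"
      then have "0 \<le> ln (real (j + 1) / real j)" using N by auto
      then show "\<bar>normalized_count l (X n / real (j + s)) * ln (real (j + 1) / real j)\<bar>
          \<le> B * ln (real (j + 1) / real j)"
        using B[of "X n / real (j + s)"] by (simp add: abs_mult mult_right_mono)
    qed
    also have "\<dots> = B * ln (real (k + 2))"
      using sum_ln_ratios[OF N, of "k + 2"] by (simp only: sum_distrib_left[symmetric])
    finally show ?thesis
      using step_weight_pos[of k]
      by (simp add: avg_def m_def abs_mult mult.left_commute mult_left_mono)
  qed
  show "summable (\<lambda>k. avg k n)"
    using summ avg_le by (rule summable_comparison_test'[where N = 0])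
  have "(\<lambda>n. avg k n) \<longlonglongrightarrow> step_weight l k *
      (\<Sum>j\<in>{N..<N * (k + 2)}. M * ln (real (j + 1) / real j))" for k
    unfolding avg_def by (intro tendsto_intros lim) (use N in auto)
  also have "(\<Sum>j\<in>{N..<N * (k + 2)}. M * ln (real (j + 1) / real j)) = M * ln (real (k + 2))" for k
    using sum_ln_ratios[OF N, of "k + 2"] by (simp only: sum_distrib_left[symmetric])
  finally have avg_lim: "(\<lambda>n. avg k n) \<longlonglongrightarrow> step_weight l k * (M * ln (real (k + 2)))" for k .
  have "eventually (\<lambda>(k, n). norm (avg k n) \<le> m k) (at_top \<times>\<^sub>F sequentially)"
    using avg_le by (intro always_eventually) auto
  from tannerys_theorem[OF avg_lim this summ sequentially_bot]
  have "(\<lambda>n. \<Sum>k. avg k n) \<longlonglongrightarrow> (\<Sum>k. step_weight l k * (M * ln (real (k + 2))))"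
    by blast
  also have "(\<Sum>k. step_weight l k * (M * ln (real (k + 2)))) = M * mean_log_step l"
    using sums_mult[OF mean_log_step_sums, of M] by (simp add: sums_iff mult.left_commute)
  finally show "(\<lambda>n. \<Sum>k. avg k n) \<longlonglongrightarrow> M * mean_log_step l" .
qed

text \<open>
  If \<open>normalized_count\<close> looks constant, equal to \<open>M\<close>, on the points \<open>X n / d\<close>, then the integrals in the
  conservation law at \<open>X n / N\<close> are \<open>M * ln (k + 2)\<close> up to factors that tend to \<open>1\<close> as \<open>N\<close> grows. The
  conservation law thus determines \<open>M\<close>.
\<close>

lemma constant_profile_value:
  assumes X: "filterlim X at_top sequentially"
    and lim: "\<And>d. d \<ge> 1 \<Longrightarrow> (\<lambda>n. normalized_count l (X n / real d)) \<longlonglongrightarrow> M"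
  shows "M * mean_log_step l = 1 / beta l"
proof -
  let ?G = "log_integral l"
  have b: "beta l > 0" using beta_gt_1 by simp
  define flux where "flux N n = (1 - (X n / real N) powr (- beta l)) / beta l" for N n
  have XN: "filterlim (\<lambda>n. X n / real N) at_top sequentially" if "N \<ge> 1" for N :: nat
    using filterlim_tendsto_pos_mult_at_top[OF tendsto_const _ X, of "1 / real N"] that by simp
  have flux: "(\<lambda>n. flux N n) \<longlonglongrightarrow> 1 / beta l" if "N \<ge> 1" for N
  proof -
    have "(\<lambda>n. (X n / real N) powr (- beta l)) \<longlonglongrightarrow> 0"
      by (rule tendsto_neg_powr[OF _ XN[OF that]]) (use b in simp)
    then have "(\<lambda>n. flux N n) \<longlonglongrightarrow> (1 - 0) / beta l"
      unfolding flux_def by (intro tendsto_intros) (use b in auto)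
    then show ?thesis by simp
  qed
  have balance: "eventually (\<lambda>n. X n > 0 \<and>
      (\<lambda>k. step_weight l k * (?G (X n / real N) - ?G (X n / real (N * (k + 2))))) sums flux N n) sequentially"
    if "N \<ge> 1" for N
    using XN[OF that, unfolded filterlim_at_top, rule_format, of 1]
      X[unfolded filterlim_at_top, rule_format, of 1]
  proof eventually_elim
    case (elim n)
    then show ?case
      using log_integral_balance[OF elim(1)]
      by (simp only: flux_def divide_divide_eq_left of_nat_mult) simp
  qed
  have lower: "(real N / real (N + 1)) powr beta l * (M * mean_log_step l) \<le> 1 / beta l"
    if N: "N \<ge> 1" for N
  proof (rule tendsto_le[OF sequentially_bot flux[OF N]])
    note avg = log_averages_tendsto[where X = X and s = 1, OF lim N]
    show "(\<lambda>n. (real N / real (N + 1)) powr beta l * (\<Sum>k. step_weight l k *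
        (\<Sum>j\<in>{N..<N * (k + 2)}. normalized_count l (X n / real (j + 1)) * ln (real (j + 1) / real j))))
        \<longlonglongrightarrow> (real N / real (N + 1)) powr beta l * (M * mean_log_step l)"
      by (rule tendsto_mult_left[OF avg(2)])
    show "eventually (\<lambda>n. (real N / real (N + 1)) powr beta l * (\<Sum>k. step_weight l k *
        (\<Sum>j\<in>{N..<N * (k + 2)}. normalized_count l (X n / real (j + 1)) * ln (real (j + 1) / real j)))
        \<le> flux N n) sequentially"
      using balance[OF N]
    proof eventually_elim
      case (elim n)
      show ?case
      proof (rule sums_le[OF _ sums_mult[OF summable_sums[OF avg(1)]] conjunct2[OF elim]])
        fix k
        show "(real N / real (N + 1)) powr beta l * (step_weight l k *
          (\<Sum>j\<in>{N..<N * (k + 2)}. normalized_count l (X n / real (j + 1)) * ln (real (j + 1) / real j)))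
          \<le> step_weight l k * (?G (X n / real N) - ?G (X n / real (N * (k + 2))))"
          by (subst mult.left_commute)
             (intro mult_left_mono log_integral_telescope_ge less_imp_le[OF step_weight_pos]
               conjunct1[OF elim] N, simp)
      qed
    qed
  qed
  have upper: "1 / beta l \<le> (real (N + 1) / real N) powr beta l * (M * mean_log_step l)"
    if N: "N \<ge> 1" for N
  proof (rule tendsto_le[OF sequentially_bot _ flux[OF N]])
    note avg = log_averages_tendsto[where X = X and s = 0, OF lim N, unfolded add_0_right]
    show "(\<lambda>n. (real (N + 1) / real N) powr beta l * (\<Sum>k. step_weight l k *
        (\<Sum>j\<in>{N..<N * (k + 2)}. normalized_count l (X n / real j) * ln (real (j + 1) / real j))))
        \<longlonglongrightarrow> (real (N + 1) / real N) powr beta l * (M * mean_log_step l)"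
      by (rule tendsto_mult_left[OF avg(2)])
    show "eventually (\<lambda>n. flux N n \<le> (real (N + 1) / real N) powr beta l * (\<Sum>k. step_weight l k *
        (\<Sum>j\<in>{N..<N * (k + 2)}. normalized_count l (X n / real j) * ln (real (j + 1) / real j)))) sequentially"
      using balance[OF N]
    proof eventually_elim
      case (elim n)
      show ?case
      proof (rule sums_le[OF _ conjunct2[OF elim] sums_mult[OF summable_sums[OF avg(1)]]])
        fix k
        show "step_weight l k * (?G (X n / real N) - ?G (X n / real (N * (k + 2))))
          \<le> (real (N + 1) / real N) powr beta l * (step_weight l k *
          (\<Sum>j\<in>{N..<N * (k + 2)}. normalized_count l (X n / real j) * ln (real (j + 1) / real j)))"
          by (subst mult.left_commute)
             (intro mult_left_mono log_integral_telescope_le less_imp_le[OF step_weight_pos]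
               conjunct1[OF elim] N, simp)
      qed
    qed
  qed
  \<comment> \<open>The factors in \<open>lower\<close> and \<open>upper\<close> are powers of ratios of consecutive integers.\<close>
  have ratio: "(\<lambda>N. (real (Suc N) / real (Suc (Suc N))) powr beta l) \<longlonglongrightarrow> 1"
  proof -
    have "(\<lambda>N. real (Suc N) / real (Suc (Suc N))) \<longlonglongrightarrow> 1"
      using LIMSEQ_Suc[OF LIMSEQ_n_over_Suc_n[where 'a = real]] by simp
    from tendsto_powr[OF this tendsto_const] show ?thesis by simp
  qed
  have inv: "(real (Suc (Suc N)) / real (Suc N)) powr beta l =
      inverse ((real (Suc N) / real (Suc (Suc N))) powr beta l)" for N
    by (simp add: powr_divide)
  show ?thesis
  proof (rule antisym)
    show "M * mean_log_step l \<le> 1 / beta l"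
      using LIMSEQ_le_const2[OF tendsto_mult_right[OF ratio, of "M * mean_log_step l"]] lower[of "Suc _"]
      by simp
    have "(\<lambda>N. (real (Suc (Suc N)) / real (Suc N)) powr beta l * (M * mean_log_step l))
        \<longlonglongrightarrow> inverse 1 * (M * mean_log_step l)"
      unfolding inv by (intro tendsto_intros ratio) simp
    then show "1 / beta l \<le> M * mean_log_step l"
      using LIMSEQ_le_const[of _ "M * mean_log_step l" "1 / beta l"] upper[of "Suc _"] by simp
  qed
qed

lemma alpha_eq: "alpha l = 1 / (beta l * mean_log_step l)"
  by (simp add: alpha_def mean_log_step_def mult_ac)

lemma alpha_pos: "alpha l > 0"
  using beta_gt_1 mean_log_step_pos by (simp add: alpha_eq)

text \<open>
  The upper and the lower limit are both attained along sequences, both propagate by the maximum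
  principle (the lower one after a change of sign), and so both equal the only possible value.
\<close>

theorem normalized_count_tendsto: "(normalized_count l \<longlongrightarrow> alpha l) at_top"
proof -
  let ?Z = "normalized_count l"
  have b: "beta l > 0" using beta_gt_1 by simp
  have alpha: "M = alpha l" if "M * mean_log_step l = 1 / beta l" for M
  proof -
    have "M = 1 / (beta l * mean_log_step l)"
      using that mean_log_step_pos b by (simp add: field_simps)
    then show ?thesis by (simp add: alpha_eq)
  qed
  obtain B where B: "\<And>x. \<bar>?Z x\<bar> \<le> B" using normalized_count_bounded by blast
  have e: "((\<lambda>x. x powr (- beta l)) \<longlongrightarrow> 0) at_top"
    by (rule tendsto_neg_powr) (use b in \<open>auto intro: filterlim_ident\<close>)
  have above: "eventually (\<lambda>x. ?Z x < alpha l + \<epsilon>) at_top" if "\<epsilon> > 0" for \<epsilon>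
  proof -
    obtain M X where M: "filterlim X at_top sequentially" "(\<lambda>n. ?Z (X n)) \<longlonglongrightarrow> M"
      "\<forall>\<epsilon>>0. eventually (\<lambda>x. ?Z x < M + \<epsilon>) at_top"
      by (rule limsup_along_sequence[of ?Z, OF B])
    have "(\<lambda>n. ?Z (X n / real d)) \<longlonglongrightarrow> M" if "d \<ge> 1" for d
      by (rule extremal_limit_propagates[OF step_weight_pos step_weight_sums B
          normalized_count_renewal e M(1,2) M(3)[rule_format] that])
    from alpha[OF constant_profile_value[OF M(1) this]] M(3)[rule_format, OF that] show ?thesis by simp
  qed
  have below: "eventually (\<lambda>x. alpha l - \<epsilon> < ?Z x) at_top" if "\<epsilon> > 0" for \<epsilon>
  proof -
    define f where "f x = - ?Z x" for x
    have f_bd: "\<bar>f x\<bar> \<le> B" for x using B by (simp add: f_def)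
    have f_ren: "(\<lambda>k. step_weight l k * f (x / real (k + 2))) sums (f x - (- (x powr (- beta l))))"
      if "x \<ge> 1" for x
      using sums_minus[OF normalized_count_renewal[OF that]] by (simp add: f_def)
    have f_e: "((\<lambda>x. - (x powr (- beta l))) \<longlongrightarrow> 0) at_top"
      using tendsto_minus[OF e] by simp
    obtain M X where M: "filterlim X at_top sequentially" "(\<lambda>n. f (X n)) \<longlonglongrightarrow> M"
      "\<forall>\<epsilon>>0. eventually (\<lambda>x. f x < M + \<epsilon>) at_top"
      by (rule limsup_along_sequence[of f, OF f_bd])
    have "(\<lambda>n. f (X n / real d)) \<longlonglongrightarrow> M" if "d \<ge> 1" for d
      by (rule extremal_limit_propagates[OF step_weight_pos step_weight_sums f_bd
          f_ren f_e M(1,2) M(3)[rule_format] that])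
    from tendsto_minus[OF this] have "(\<lambda>n. ?Z (X n / real d)) \<longlonglongrightarrow> - M" if "d \<ge> 1" for d
      using that by (simp add: f_def)
    from alpha[OF constant_profile_value[OF M(1) this]] have "M = - alpha l" by simp
    with M(3)[rule_format, OF that] show ?thesis by (simp add: f_def) (erule eventually_mono, simp)
  qed
  show ?thesis
  proof (rule order_tendstoI)
    fix a assume "a < alpha l"
    then show "eventually (\<lambda>x. a < ?Z x) at_top" using below[of "alpha l - a"] by simp
  next
    fix a assume "alpha l < a"
    then show "eventually (\<lambda>x. ?Z x < a) at_top" using above[of "a - alpha l"] by simp
  qed
qed

end

theorem corollary10:
  fixes l :: nat
  assumes "l \<ge> 1"
  shows "(\<lambda>x::real. 1 / x * (\<Sum>n | 1 \<le> n \<and> real n \<le> x. real (num_colored_factorizations l n)))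
           \<sim>[at_top] (\<lambda>x. alpha l * x powr (beta l - 1))"
proof (rule asymp_equivI')
  have pos: "alpha l > 0" by (rule alpha_pos[OF assms])
  have "((\<lambda>x. normalized_count l x / alpha l) \<longlongrightarrow> alpha l / alpha l) at_top"
    using pos by (intro tendsto_intros normalized_count_tendsto assms) auto
  then have lim: "((\<lambda>x. normalized_count l x / alpha l) \<longlongrightarrow> 1) at_top" using pos by simp
  have count: "weighted_count l 0 x = (\<Sum>n | 1 \<le> n \<and> real n \<le> x. real (num_colored_factorizations l n))" for x
    unfolding weighted_count_def by (intro sum.cong) auto
  show "((\<lambda>x. 1 / x * (\<Sum>n | 1 \<le> n \<and> real n \<le> x. real (num_colored_factorizations l n)) /
      (alpha l * x powr (beta l - 1))) \<longlongrightarrow> 1) at_top"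
  proof (rule Lim_transform_eventually[OF lim])
    show "eventually (\<lambda>x. normalized_count l x / alpha l =
        1 / x * (\<Sum>n | 1 \<le> n \<and> real n \<le> x. real (num_colored_factorizations l n)) /
        (alpha l * x powr (beta l - 1))) at_top"
      using eventually_gt_at_top[of 0]
    proof eventually_elim
      case (elim x)
      then have "normalized_count l x = 1 / x * weighted_count l 0 x / x powr (beta l - 1)"
        by (simp add: normalized_count_def powr_diff powr_minus field_simps)
      then show ?case unfolding count by simp
    qed
  qed
qed

end
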